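(* Let $(B(t))_{t\ge 0}$ be a standard Brownian motion, let $S(t)=\max_{0\le s\le t}B(s)$, and let $\mathcal{A}=\int_0^1 S(t)\,dt$. Then for every $n\in\mathbb{N}$, \[ \mathbb{E}\,\mathcal{A}^n=\frac{n!\,\Gamma(n+2/3)}{\Gamma(2/3)\,\Gamma(3n/2+1)}\Bigl(\frac{3\sqrt2}{4}\Bigr)^n . \] *)

theory Defs
  imports "HOL-Probability.Probability"
begin

definition standard_brownian_motion :: "'a measure \<Rightarrow> (real \<Rightarrow> 'a \<Rightarrow> real) \<Rightarrow> bool" where
  "standard_brownian_motion M B \<longleftrightarrow>
     prob_space M \<and>
     (\<forall>t\<ge>0. B t \<in> borel_measurable M) \<and>
     (\<forall>\<omega>\<in>space M. B 0 \<omega> = 0 \<and> continuous_on {0..} (\<lambda>t. B t \<omega>)) \<and>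
     (\<forall>(ts :: nat \<Rightarrow> real) (n :: nat).
        (0 \<le> ts 0 \<and> (\<forall>i<n. ts i < ts (Suc i))) \<longrightarrow>
          prob_space.indep_vars M (\<lambda>_. borel) (\<lambda>i \<omega>. B (ts (Suc i)) \<omega> - B (ts i) \<omega>) {..<n} \<and>
          (\<forall>i<n. distributed M lborel (\<lambda>\<omega>. B (ts (Suc i)) \<omega> - B (ts i) \<omega>)
                    (\<lambda>x. ennreal (normal_density 0 (sqrt (ts (Suc i) - ts i)) x))))"

definition running_max :: "(real \<Rightarrow> 'a \<Rightarrow> real) \<Rightarrow> real \<Rightarrow> 'a \<Rightarrow> real" where
  "running_max B t \<omega> = Sup ((\<lambda>s. B s \<omega>) ` {0..t})"

definition max_area :: "(real \<Rightarrow> 'a \<Rightarrow> real) \<Rightarrow> 'a \<Rightarrow> real" where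
  "max_area B \<omega> = integral {0..1} (\<lambda>t. running_max B t \<omega>)"

end

theory Submission
  imports Defs
begin

text \<open>
  By monotone convergence along dyadic grids, the moments of \<open>\<A>\<close> are limits of rescaled moments of
  the sum of the running maxima of a walk with independent standard Gaussian steps. Restarting the
  walk at the times when its maximum increases gives an exact recursion for the latter moments; by
  a cyclic rotation argument (as in Spitzer's identity) the maximum grows at step \<open>j\<close> by
  \<open>1 / sqrt (2 * pi * j)\<close> on average. To leading order only the first moments of these increments
  contribute, and the recursion becomes a Beta integral in the limit.
\<close>

text \<open>The times at which a Brownian maximum grows almost surely form an uncountable null set,
  so restarting at each of them does not give a sum; for a walk it gives a finite telescoping one.
  The area over K steps has order K^(3/2). In the recursion, the r-th power of an increment trades
  an area factor of order K^(3r/2) for K^r times a sum of K increment moments. For r = 1 that sum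
  has order K^(1/2), and the orders match. For r >= 2 bounded moments give only K^(r+1), which is
  still of critical order when r = 2. Hence these moments must be shown to tend to 0 on
  average.\<close>

section \<open>Walks: maxima, areas and restarts\<close>

definition walk :: "(nat \<Rightarrow> real) \<Rightarrow> nat \<Rightarrow> real" where
  "walk x k = (\<Sum>i<k. x i)"

fun walk_max :: "(nat \<Rightarrow> real) \<Rightarrow> nat \<Rightarrow> real" where
  "walk_max x 0 = 0"
| "walk_max x (Suc k) = max (walk_max x k) (walk x (Suc k))"

text \<open>Left endpoints: as the maxima grow in time, the scaled areas of a walk embedded in a
  path increase when the grid is halved, as monotone convergence will require.\<close>

definition walk_area :: "(nat \<Rightarrow> real) \<Rightarrow> nat \<Rightarrow> real" where
  "walk_area x K = (\<Sum>k<K. walk_max x k)"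

definition max_incr :: "(nat \<Rightarrow> real) \<Rightarrow> nat \<Rightarrow> real" where
  "max_incr x j = walk_max x (Suc j) - walk_max x j"

definition shift_seq :: "nat \<Rightarrow> (nat \<Rightarrow> real) \<Rightarrow> nat \<Rightarrow> real" where
  "shift_seq j x = (\<lambda>i. x (j + i))"

lemma walk_0 [simp]: "walk x 0 = 0"
  and walk_Suc: "walk x (Suc k) = walk x k + x k"
  by (simp_all add: walk_def)

lemma walk_shift: "walk (shift_seq j x) k = walk x (j + k) - walk x j"
  by (induction k) (simp_all add: walk_Suc shift_seq_def)

lemma walk_max_ge_walk: "walk x k \<le> walk_max x k"
  by (cases k) auto

lemma walk_max_nonneg: "0 \<le> walk_max x k"
  by (induction k) auto

lemma walk_max_eq_Max: "walk_max x k = Max (walk x ` {..k})"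
  by (induction k) (simp_all add: atMost_Suc max.commute)

text \<open>After time j the path is the restarted walk raised by \<open>walk x j\<close>.\<close>

lemma walk_max_shift:
  "walk_max x (j + k) = max (walk_max x j) (walk x j + walk_max (shift_seq j x) k)"
proof (induction k)
  case 0
  then show ?case using walk_max_ge_walk[of x j] by simp
next
  case (Suc k)
  then show ?case using walk_shift[of j x "Suc k"] by (simp add: max_def)
qed

lemma walk_cong: "(\<And>i. i < k \<Longrightarrow> x i = y i) \<Longrightarrow> walk x k = walk y k"
  by (simp add: walk_def)

lemma walk_max_cong: "(\<And>i. i < k \<Longrightarrow> x i = y i) \<Longrightarrow> walk_max x k = walk_max y k"
  by (induction k) (auto intro!: arg_cong2[where f=max] walk_cong)

lemma walk_area_cong: "(\<And>i. i < K \<Longrightarrow> x i = y i) \<Longrightarrow> walk_area x K = walk_area y K"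
  unfolding walk_area_def by (intro sum.cong refl walk_max_cong) auto

lemma max_incr_cong: "(\<And>i. i \<le> j \<Longrightarrow> x i = y i) \<Longrightarrow> max_incr x j = max_incr y j"
  unfolding max_incr_def by (intro arg_cong2[where f="(-)"] walk_max_cong) auto

lemma walk_area_nonneg: "0 \<le> walk_area x K"
  by (simp add: walk_area_def sum_nonneg walk_max_nonneg)

lemma max_incr_nonneg: "0 \<le> max_incr x j"
  by (simp add: max_incr_def)

text \<open>The walk never lies above its maximum, so a step lifts the maximum by at most its own
  size. This bounds the increment moments uniformly in j.\<close>

lemma max_incr_le: "max_incr x j \<le> \<bar>x j\<bar>"
  using walk_max_ge_walk[of x j] by (simp add: max_incr_def walk_Suc max_def)

lemma walk_scale: "walk (\<lambda>i. c * x i) k = c * walk x k"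
  by (simp add: walk_def sum_distrib_left)

lemma walk_max_scale: "0 \<le> c \<Longrightarrow> walk_max (\<lambda>i. c * x i) k = c * walk_max x k"
  by (induction k) (simp_all add: walk_scale max_mult_distrib_left)

lemma walk_area_scale: "0 \<le> c \<Longrightarrow> walk_area (\<lambda>i. c * x i) K = c * walk_area x K"
  by (simp add: walk_area_def walk_max_scale sum_distrib_left)

text \<open>The walk stands at its maximum right after a step that increases the maximum. The area above
  the level reached then is the area of the walk restarted at that time.\<close>
lemma walk_area_power_decomp:
  assumes "n > 0"
  shows "walk_area x (Suc K) ^ n =
    (\<Sum>j<K. \<Sum>r=1..n. real (n choose r) *
       (real (K - j) ^ r * (max_incr x j ^ r * walk_area (shift_seq (Suc j) x) (K - j) ^ (n - r))))"
proof -
  \<comment> \<open>Area above the level \<open>walk_max x j\<close>, over the times j to K. It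
    falls from the full area at j = 0 to 0 at j = K, so its n-th powers telescope to the left-hand
    side.\<close>
  define R where "R j = (\<Sum>k=j..K. walk_max x k - walk_max x j)" for j
  have R0: "R 0 = walk_area x (Suc K)"
    by (simp add: R_def walk_area_def lessThan_Suc_atMost atMost_atLeast0)
  have RK: "R K = 0"
    by (simp add: R_def)
  have step: "R j ^ n - R (Suc j) ^ n = (\<Sum>r=1..n. real (n choose r) *
       (real (K - j) ^ r * (max_incr x j ^ r * walk_area (shift_seq (Suc j) x) (K - j) ^ (n - r))))"
    if "j < K" for j
  proof -
    have "R j = (\<Sum>k=Suc j..K. walk_max x k - walk_max x j)"
      unfolding R_def using that by (subst sum.atLeast_Suc_atMost) auto
    also have "\<dots> = (\<Sum>k=Suc j..K. (walk_max x k - walk_max x (Suc j)) + max_incr x j)"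
      by (intro sum.cong) (auto simp: max_incr_def)
    also have "\<dots> = R (Suc j) + real (K - j) * max_incr x j"
      unfolding sum.distrib R_def by simp
    finally have Rj: "R j = real (K - j) * max_incr x j + R (Suc j)" by simp
    show ?thesis
    proof (cases "max_incr x j = 0")
      case True
      then show ?thesis using Rj by (simp add: power_0_left)
    next
      case False
      then have top: "walk x (Suc j) = walk_max x (Suc j)"
        by (auto simp: max_incr_def max_def split: if_splits)
      have "R (Suc j) = (\<Sum>i<K - j. walk_max x (Suc j + i) - walk_max x (Suc j))"
        unfolding R_def using that
        by (intro sum.reindex_bij_witness[of _ "\<lambda>i. Suc j + i" "\<lambda>k. k - Suc j"]) auto
      also have "\<dots> = walk_area (shift_seq (Suc j) x) (K - j)"
        unfolding walk_area_def
      proof (intro sum.cong refl)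
        fix i
        show "walk_max x (Suc j + i) - walk_max x (Suc j) = walk_max (shift_seq (Suc j) x) i"
          using walk_max_nonneg[of "shift_seq (Suc j) x" i] top
          by (subst walk_max_shift) simp
      qed
      finally have RS: "R (Suc j) = walk_area (shift_seq (Suc j) x) (K - j)" .
      have "R j ^ n = (\<Sum>r\<le>n. real (n choose r) *
          (real (K - j) * max_incr x j) ^ r * R (Suc j) ^ (n - r))"
        unfolding Rj by (rule binomial_ring)
      also have "\<dots> = R (Suc j) ^ n + (\<Sum>r=1..n. real (n choose r) *
          (real (K - j) * max_incr x j) ^ r * R (Suc j) ^ (n - r))"
        unfolding atMost_atLeast0 by (subst sum.atLeast_Suc_atMost) auto
      finally show ?thesis
        by (simp add: RS power_mult_distrib mult.assoc)
    qed
  qed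
  have "walk_area x (Suc K) ^ n = (\<Sum>j<K. R j ^ n - R (Suc j) ^ n)"
    using assms by (subst sum_lessThan_telescope') (simp add: R0 RK)
  then show ?thesis
    using step by simp
qed

text \<open>Extend the first \<open>m\<close> steps periodically to a walk \<open>V\<close>. If \<open>V m \<ge> 0\<close>, the summands are the
  increments of the maximum of \<open>V\<close> over a moving window of length \<open>m\<close>, so the sum telescopes.\<close>
lemma sum_max_incr_rotations:
  fixes x :: "nat \<Rightarrow> real" and p :: nat
  defines "m \<equiv> Suc p"
  shows "(\<Sum>i<m. max_incr (\<lambda>l. x ((i + l) mod m)) p) = max 0 (walk x m)"
proof -
  define y where "y l = x (l mod m)" for l
  define V where "V = walk y"
  have y_period: "shift_seq m y = y"
    by (simp add: fun_eq_iff shift_seq_def y_def)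
  have y_start: "shift_seq 0 y = y"
    by (simp add: shift_seq_def)
  have V_period: "V (m + l) = V m + V l" for l
    using walk_shift[of m y l] by (simp add: V_def y_period)
  have Vm: "V m = walk x m"
    unfolding V_def by (intro walk_cong) (simp add: y_def)
  have eq: "(\<lambda>l. x ((i + l) mod m)) = shift_seq i y" for i
    by (simp add: fun_eq_iff shift_seq_def y_def)
  have walk_m: "walk (shift_seq i y) m = V m" for i
    using V_period[of i] walk_shift[of i y m] by (simp add: V_def add.commute)
  show ?thesis
  proof (cases "V m < 0")
    case True
    \<comment> \<open>Every rotation ends at \<open>V m\<close>, below its starting level, so its
      last step sets no new maximum.\<close>
    have "max_incr (shift_seq i y) p = 0" for i
      using walk_m[of i] walk_max_nonneg[of "shift_seq i y" p] True
      by (simp add: max_incr_def m_def max_def)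
    then show ?thesis using True by (simp add: eq Vm)
  next
    case False
    \<comment> \<open>Maximum of \<open>V\<close> over the window from i to i + p.\<close>
    define N where "N i = V i + walk_max (shift_seq i y) p" for i
    have incr: "max_incr (shift_seq i y) p = N (Suc i) - N i" for i
    proof -
      have sh: "shift_seq 1 (shift_seq i y) = shift_seq (Suc i) y"
        by (simp add: fun_eq_iff shift_seq_def)
      have w1: "walk (shift_seq i y) 1 = V (Suc i) - V i"
        using walk_shift[of i y 1] by (simp add: V_def)
      \<comment> \<open>The time m + i entering the window carries a value at least
        \<open>V i\<close>, so dropping the time i loses nothing.\<close>
      have "V (m + i) \<le> N (Suc i)"
        using walk_max_ge_walk[of "shift_seq (Suc i) y" p] walk_shift[of "Suc i" y p]
        by (simp add: N_def V_def m_def add.commute)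
      then have "V i \<le> N (Suc i)"
        using False V_period[of i] by simp
      moreover have "walk_max (shift_seq i y) (1 + p) =
          max (walk_max (shift_seq i y) 1) (walk (shift_seq i y) 1 + walk_max (shift_seq (Suc i) y) p)"
        by (subst walk_max_shift) (simp only: sh)
      ultimately have "walk_max (shift_seq i y) (Suc p) = N (Suc i) - V i"
        using w1 walk_max_nonneg[of "shift_seq (Suc i) y" p] by (simp add: N_def max_def)
      then show ?thesis by (simp add: max_incr_def N_def)
    qed
    have "(\<Sum>i<m. max_incr (shift_seq i y) p) = N m - N 0"
      by (simp add: incr sum_lessThan_telescope)
    also have "\<dots> = V m"
      using V_period[of 0] by (simp add: N_def y_period y_start V_def)
    finally show ?thesis using False by (simp add: eq Vm)
  qed
qed

section \<open>Independent Gaussian steps\<close>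

definition gauss :: "real measure" where
  "gauss = density lborel (\<lambda>x. ennreal (std_normal_density x))"

text \<open>Infinite sequences, although each quantity uses finitely many steps: restarting then
  maps one probability space to itself.\<close>

abbreviation gauss_seq :: "(nat \<Rightarrow> real) measure" where
  "gauss_seq \<equiv> PiM UNIV (\<lambda>_. gauss)"

lemma prob_space_gauss: "prob_space gauss"
  unfolding gauss_def by (rule prob_space_normal_density) simp

lemma sets_gauss [simp, measurable_cong]: "sets gauss = sets borel"
  by (simp add: gauss_def)

lemma space_gauss [simp]: "space gauss = UNIV"
  by (simp add: gauss_def)

lemma sequence_space_gauss: "sequence_space gauss"
proof -
  interpret prob_space gauss by (rule prob_space_gauss)
  show ?thesis
    by (simp add: sequence_space_def product_prob_space_def product_sigma_finite_def
        product_prob_space_axioms_def prob_space_gauss sigma_finite_measure_axioms)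
qed

lemma measurable_gauss_seq_component [measurable]:
  "(\<lambda>x. x i) \<in> borel_measurable gauss_seq"
  using measurable_component_singleton[of i UNIV "\<lambda>_. gauss"]
  by (simp add: measurable_cong_sets[OF refl sets_gauss])

lemma measurable_walk [measurable]: "(\<lambda>x. walk x k) \<in> borel_measurable gauss_seq"
  unfolding walk_def by measurable

lemma measurable_walk_max [measurable]: "(\<lambda>x. walk_max x k) \<in> borel_measurable gauss_seq"
  by (induction k) simp_all

lemma measurable_walk_area [measurable]: "(\<lambda>x. walk_area x k) \<in> borel_measurable gauss_seq"
  unfolding walk_area_def by measurable

lemma measurable_max_incr [measurable]: "(\<lambda>x. max_incr x k) \<in> borel_measurable gauss_seq"
  unfolding max_incr_def by measurable

lemma measurable_reindex_gauss_seq: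
  fixes \<rho> :: "nat \<Rightarrow> nat"
  shows "(\<lambda>x l. x (\<rho> l)) \<in> gauss_seq \<rightarrow>\<^sub>M gauss_seq"
  by (rule measurable_PiM_single') (auto simp: measurable_cong_sets[OF refl sets_gauss])

lemma measurable_shift_seq: "shift_seq j \<in> gauss_seq \<rightarrow>\<^sub>M gauss_seq"
  unfolding shift_seq_def using measurable_reindex_gauss_seq[of "\<lambda>i. j + i"] by simp

text \<open>Gluing the first j entries of one sequence to an independent second sequence reproduces
  the product law; \<open>f\<close> sees only the first sequence and the shifted \<open>g\<close>
  only the second.\<close>

lemma nn_integral_split_gauss_seq:
  assumes [measurable]: "f \<in> borel_measurable gauss_seq" "g \<in> borel_measurable gauss_seq"
    and f: "\<And>x y. (\<And>i. i < j \<Longrightarrow> x i = y i) \<Longrightarrow> f x = f y"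
  shows "(\<integral>\<^sup>+x. f x * g (shift_seq j x) \<partial>gauss_seq) =
    (\<integral>\<^sup>+x. f x \<partial>gauss_seq) * (\<integral>\<^sup>+x. g x \<partial>gauss_seq)"
proof -
  interpret sequence_space gauss by (rule sequence_space_gauss)
  note [measurable] = measurable_shift_seq
  have "(\<integral>\<^sup>+x. f x * g (shift_seq j x) \<partial>gauss_seq) =
      (\<integral>\<^sup>+x. f x * g (shift_seq j x)
        \<partial>distr (gauss_seq \<Otimes>\<^sub>M gauss_seq) gauss_seq (\<lambda>(x, y). comb_seq j x y))"
    by (simp only: PiM_comb_seq)
  also have "\<dots> = (\<integral>\<^sup>+z. f (comb_seq j (fst z) (snd z)) *
      g (shift_seq j (comb_seq j (fst z) (snd z))) \<partial>(gauss_seq \<Otimes>\<^sub>M gauss_seq))"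
    by (subst nn_integral_distr) (auto simp: case_prod_unfold)
  also have "\<dots> = (\<integral>\<^sup>+z. f (fst z) * g (snd z) \<partial>(gauss_seq \<Otimes>\<^sub>M gauss_seq))"
  proof (intro nn_integral_cong arg_cong2[where f="(*)"])
    fix z :: "(nat \<Rightarrow> real) \<times> (nat \<Rightarrow> real)"
    show "f (comb_seq j (fst z) (snd z)) = f (fst z)"
      by (rule f) (simp add: comb_seq_def)
    show "g (shift_seq j (comb_seq j (fst z) (snd z))) = g (snd z)"
      by (simp add: shift_seq_def comb_seq_def)
  qed
  also have "\<dots> = (\<integral>\<^sup>+x. \<integral>\<^sup>+y. f x * g y \<partial>gauss_seq \<partial>gauss_seq)"
    by (subst P.nn_integral_fst[symmetric]) auto
  also have "\<dots> = (\<integral>\<^sup>+x. f x \<partial>gauss_seq) * (\<integral>\<^sup>+x. g x \<partial>gauss_seq)"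
    by (simp add: nn_integral_cmult nn_integral_multc)
  finally show ?thesis .
qed

lemma distr_gauss_seq_component: "distr gauss_seq borel (\<lambda>x. x i) = gauss"
proof -
  interpret sequence_space gauss by (rule sequence_space_gauss)
  show ?thesis
    using PiM_component[of i] distr_cong[OF refl sets_gauss, of gauss_seq "\<lambda>x. x i" "\<lambda>x. x i"]
    by simp
qed

lemma gauss_abs_moment_finite: "(\<integral>\<^sup>+t. ennreal (\<bar>t\<bar> ^ r) \<partial>gauss) < \<infinity>"
proof -
  have "(\<integral>\<^sup>+t. ennreal (\<bar>t\<bar> ^ r) \<partial>gauss) =
      (\<integral>\<^sup>+t. ennreal (std_normal_density t * \<bar>t\<bar> ^ r) \<partial>lborel)"
    unfolding gauss_def by (subst nn_integral_density) (auto simp: ennreal_mult)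
  also have "\<dots> < \<infinity>"
    using integrable_std_normal_moment_abs[of r] by (simp add: integrable_iff_bounded abs_mult)
  finally show ?thesis .
qed

section \<open>Moments of increments and areas, and their recursion\<close>

definition gauss_abs_moment :: "nat \<Rightarrow> real" where
  "gauss_abs_moment r = enn2real (\<integral>\<^sup>+t. ennreal (\<bar>t\<bar> ^ r) \<partial>gauss)"

definition incr_moment :: "nat \<Rightarrow> nat \<Rightarrow> real" where
  "incr_moment r j = enn2real (\<integral>\<^sup>+x. ennreal (max_incr x j ^ r) \<partial>gauss_seq)"

text \<open>\<open>enn2real\<close> would send an infinite moment to 0;
  \<open>nn_integral_walk_area\<close> rules that case out.\<close>

definition area_moment :: "nat \<Rightarrow> nat \<Rightarrow> real" where
  "area_moment n K = enn2real (\<integral>\<^sup>+x. ennreal (walk_area x K ^ n) \<partial>gauss_seq)"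

lemma nn_integral_max_incr_le:
  "(\<integral>\<^sup>+x. ennreal (max_incr x j ^ r) \<partial>gauss_seq) \<le> ennreal (gauss_abs_moment r)"
proof -
  have "(\<integral>\<^sup>+x. ennreal (max_incr x j ^ r) \<partial>gauss_seq) \<le>
      (\<integral>\<^sup>+x. ennreal (\<bar>x j\<bar> ^ r) \<partial>gauss_seq)"
    by (intro nn_integral_mono ennreal_leI power_mono max_incr_le max_incr_nonneg)
  also have "\<dots> = (\<integral>\<^sup>+t. ennreal (\<bar>t\<bar> ^ r) \<partial>distr gauss_seq borel (\<lambda>x. x j))"
    by (subst nn_integral_distr) auto
  also have "\<dots> = ennreal (gauss_abs_moment r)"
    using gauss_abs_moment_finite[of r]
    by (simp add: distr_gauss_seq_component gauss_abs_moment_def)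
  finally show ?thesis .
qed

lemma nn_integral_max_incr:
  "(\<integral>\<^sup>+x. ennreal (max_incr x j ^ r) \<partial>gauss_seq) = ennreal (incr_moment r j)"
  using nn_integral_max_incr_le[of j r] le_less_trans[OF _ ennreal_less_top]
  by (auto simp: incr_moment_def)

lemma incr_moment_nonneg: "0 \<le> incr_moment r j"
  by (simp add: incr_moment_def)

lemma incr_moment_le: "incr_moment r j \<le> gauss_abs_moment r"
  using nn_integral_max_incr_le[of j r]
  by (simp add: nn_integral_max_incr ennreal_le_iff gauss_abs_moment_def)

lemma area_moment_nonneg: "0 \<le> area_moment n K"
  by (simp add: area_moment_def)

lemma ennreal_sum_sum:
  "(\<And>i j. 0 \<le> f i j) \<Longrightarrow> ennreal (\<Sum>i\<in>A. \<Sum>j\<in>B. f i j) = (\<Sum>i\<in>A. \<Sum>j\<in>B. ennreal (f i j))"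
  by (simp add: sum_nonneg flip: sum_ennreal)

text \<open>The increment at step j depends on the first \<open>Suc j\<close> entries and the
  restarted area on the later ones, so expectations factor. Area moments stay in
  \<open>ennreal\<close> here, since their finiteness is deduced from this recursion.\<close>

lemma nn_integral_area_Suc:
  assumes "n > 0"
  shows "(\<integral>\<^sup>+x. ennreal (walk_area x (Suc K) ^ n) \<partial>gauss_seq) =
    (\<Sum>j<K. \<Sum>r=1..n. ennreal (real (n choose r) * real (K - j) ^ r * incr_moment r j) *
       (\<integral>\<^sup>+x. ennreal (walk_area x (K - j) ^ (n - r)) \<partial>gauss_seq))"
proof -
  have "(\<integral>\<^sup>+x. ennreal (walk_area x (Suc K) ^ n) \<partial>gauss_seq) =
    (\<integral>\<^sup>+x. (\<Sum>j<K. \<Sum>r=1..n. ennreal (real (n choose r)) * (ennreal (real (K - j) ^ r) *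
       (ennreal (max_incr x j ^ r) *
        ennreal (walk_area (shift_seq (Suc j) x) (K - j) ^ (n - r))))) \<partial>gauss_seq)"
    unfolding walk_area_power_decomp[OF assms]
    by (subst ennreal_sum_sum) (simp_all add: ennreal_mult max_incr_nonneg walk_area_nonneg)
  also have "\<dots> = (\<Sum>j<K. \<Sum>r=1..n. ennreal (real (n choose r)) * (ennreal (real (K - j) ^ r) *
       (\<integral>\<^sup>+x. ennreal (max_incr x j ^ r) *
        ennreal (walk_area (shift_seq (Suc j) x) (K - j) ^ (n - r)) \<partial>gauss_seq)))"
  proof -
    note [measurable] = measurable_compose[OF measurable_shift_seq measurable_walk_area]
    show ?thesis by (simp add: nn_integral_sum nn_integral_cmult)
  qed
  also have "\<dots> = (\<Sum>j<K. \<Sum>r=1..n. ennreal (real (n choose r) * real (K - j) ^ r * incr_moment r j) *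
       (\<integral>\<^sup>+x. ennreal (walk_area x (K - j) ^ (n - r)) \<partial>gauss_seq))"
  proof (intro sum.cong refl)
    fix j r
    have "(\<integral>\<^sup>+x. ennreal (max_incr x j ^ r) *
        ennreal (walk_area (shift_seq (Suc j) x) (K - j) ^ (n - r)) \<partial>gauss_seq) =
        (\<integral>\<^sup>+x. ennreal (max_incr x j ^ r) \<partial>gauss_seq) *
        (\<integral>\<^sup>+x. ennreal (walk_area x (K - j) ^ (n - r)) \<partial>gauss_seq)"
      by (rule nn_integral_split_gauss_seq)
        (auto intro!: arg_cong[where f="\<lambda>d. ennreal (d ^ r)"] max_incr_cong)
    then show "ennreal (real (n choose r)) * (ennreal (real (K - j) ^ r) *
       (\<integral>\<^sup>+x. ennreal (max_incr x j ^ r) *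
        ennreal (walk_area (shift_seq (Suc j) x) (K - j) ^ (n - r)) \<partial>gauss_seq)) =
        ennreal (real (n choose r) * real (K - j) ^ r * incr_moment r j) *
       (\<integral>\<^sup>+x. ennreal (walk_area x (K - j) ^ (n - r)) \<partial>gauss_seq)"
      by (simp add: nn_integral_max_incr ennreal_mult incr_moment_nonneg mult.assoc)
  qed
  finally show ?thesis .
qed

lemma nn_integral_walk_area:
  "(\<integral>\<^sup>+x. ennreal (walk_area x K ^ n) \<partial>gauss_seq) = ennreal (area_moment n K)"
proof -
  interpret sequence_space gauss by (rule sequence_space_gauss)
  have "(\<integral>\<^sup>+x. ennreal (walk_area x K ^ n) \<partial>gauss_seq) < \<infinity>"
  \<comment> \<open>Every term of the recursion has r >= 1 and so involves a lower power of the
    area.\<close>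
  proof (induction n arbitrary: K rule: less_induct)
    case (less n)
    show ?case
    proof (cases "n = 0 \<or> K = 0")
      case True
      then show ?thesis
        by (cases "n = 0") (auto simp: walk_area_def P.emeasure_space_1 power_0_left)
    next
      case False
      then obtain k where K: "K = Suc k" by (cases K) auto
      show ?thesis
        unfolding K using False less.IH
        by (subst nn_integral_area_Suc) (auto simp: ennreal_mult_less_top)
    qed
  qed
  then show ?thesis by (simp add: area_moment_def)
qed

lemma area_moment_0: "area_moment 0 K = 1"
proof -
  interpret sequence_space gauss by (rule sequence_space_gauss)
  show ?thesis by (simp add: area_moment_def P.emeasure_space_1)
qed

lemma area_moment_Suc:
  assumes "n > 0"
  shows "area_moment n (Suc K) = (\<Sum>j<K. \<Sum>r=1..n.
    real (n choose r) * real (K - j) ^ r * incr_moment r j * area_moment (n - r) (K - j))"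
proof -
  have "ennreal (area_moment n (Suc K)) = ennreal (\<Sum>j<K. \<Sum>r=1..n.
    real (n choose r) * real (K - j) ^ r * incr_moment r j * area_moment (n - r) (K - j))"
    using nn_integral_area_Suc[OF assms, of K]
    by (subst ennreal_sum_sum)
      (simp_all add: nn_integral_walk_area incr_moment_nonneg area_moment_nonneg flip: ennreal_mult)
  then show ?thesis
    by (subst (asm) ennreal_inj)
      (auto intro!: sum_nonneg mult_nonneg_nonneg incr_moment_nonneg area_moment_nonneg)
qed

section \<open>Mean growth of the maximum\<close>

text \<open>Distinct coordinates of an i.i.d. sequence are again i.i.d.; this gives all rotations of
  a walk the same law.\<close>

lemma nn_integral_reindex_gauss_seq:
  assumes "inj \<rho>" and [measurable]: "f \<in> borel_measurable gauss_seq"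
  shows "(\<integral>\<^sup>+x. f (\<lambda>l. x (\<rho> l)) \<partial>gauss_seq) = (\<integral>\<^sup>+x. f x \<partial>gauss_seq)"
proof -
  note [measurable] = measurable_reindex_gauss_seq
  have "distr gauss_seq gauss_seq (\<lambda>x l. x (\<rho> l)) = gauss_seq"
    using distr_PiM_reindex[of UNIV "\<lambda>_. gauss" \<rho> UNIV] assms(1) prob_space_gauss
    by (simp add: restrict_UNIV)
  then have "(\<integral>\<^sup>+x. f x \<partial>gauss_seq) = (\<integral>\<^sup>+x. f x \<partial>distr gauss_seq gauss_seq (\<lambda>x l. x (\<rho> l)))"
    by simp
  also have "\<dots> = (\<integral>\<^sup>+x. f (\<lambda>l. x (\<rho> l)) \<partial>gauss_seq)"
    by (subst nn_integral_distr) auto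
  finally show ?thesis by simp
qed

lemma distributed_walk:
  "distributed gauss_seq lborel (\<lambda>x. walk x (Suc p)) (normal_density 0 (sqrt (Suc p)))"
proof -
  interpret sequence_space gauss by (rule sequence_space_gauss)
  have "P.indep_vars (\<lambda>_. borel) (\<lambda>i x. x i) {..p}"
  proof (subst P.indep_vars_iff_distr_eq_PiM')
    show "distr gauss_seq (Pi\<^sub>M {..p} (\<lambda>_. borel)) (\<lambda>x. \<lambda>i\<in>{..p}. x i) =
        Pi\<^sub>M {..p} (\<lambda>i. distr gauss_seq borel (\<lambda>x. x i))"
      unfolding distr_gauss_seq_component
      using distr_PiM_reindex[of UNIV "\<lambda>_. gauss" "\<lambda>i. i" "{..p}"] prob_space_gauss
      by (subst distr_cong[OF refl sets_PiM_cong[OF refl sets_gauss[symmetric]] refl]) auto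
  qed auto
  moreover have "distributed gauss_seq lborel (\<lambda>x. x i) (normal_density 0 1)" for i
    using distr_gauss_seq_component[of i]
    by (auto simp: distributed_def gauss_def distr_cong[OF refl sets_lborel])
  ultimately have "distributed gauss_seq lborel (\<lambda>x. \<Sum>i\<in>{..p}. x i)
      (normal_density (\<Sum>i\<in>{..p}. 0) (sqrt (\<Sum>i\<in>{..p}. 1\<^sup>2)))"
    by (intro P.sum_indep_normal) auto
  then show ?thesis
    by (simp add: walk_def lessThan_Suc_atMost add.commute)
qed

text \<open>The positive part is (|t| + t) / 2 and the mean is 0, so this is half the first absolute
  moment \<open>\<sigma> * sqrt (2 / pi)\<close>.\<close>

lemma nn_integral_pos_part_normal:
  assumes "\<sigma> > 0"
  shows "(\<integral>\<^sup>+t. ennreal (normal_density 0 \<sigma> t * max 0 t) \<partial>lborel) = ennreal (\<sigma> / sqrt (2 * pi))"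
proof -
  have "has_bochner_integral lborel (\<lambda>t. (normal_density 0 \<sigma> t * \<bar>t\<bar> + normal_density 0 \<sigma> t * t) / 2)
     ((\<sigma> * sqrt (2 / pi) + 0) / 2)"
    using normal_moment_abs_odd[OF assms, of 0 0] normal_moment_odd[OF assms, of 0 0]
    by (intro has_bochner_integral_divide_zero has_bochner_integral_add) auto
  moreover have "(normal_density 0 \<sigma> t * \<bar>t\<bar> + normal_density 0 \<sigma> t * t) / 2 =
      normal_density 0 \<sigma> t * max 0 t" for t
    by (simp add: max_def)
  moreover have "(\<sigma> * sqrt (2 / pi) + 0) / 2 = \<sigma> / sqrt (2 * pi)"
    by (simp add: real_sqrt_divide real_sqrt_mult field_simps flip: power2_eq_square)
  ultimately have "has_bochner_integral lborel (\<lambda>t. normal_density 0 \<sigma> t * max 0 t) (\<sigma> / sqrt (2 * pi))"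
    by simp
  then show ?thesis
    using assms by (intro nn_integral_eq_integral[THEN trans])
      (auto simp: has_bochner_integral_iff)
qed

text \<open>The m = p + 1 rotations contribute equally, and together they give the mean positive
  part of a normal variable of variance m, which is sqrt m / sqrt (2 pi).\<close>

lemma incr_moment_1: "incr_moment 1 p = 1 / sqrt (2 * pi * real (Suc p))"
proof -
  define m where "m = Suc p"
  have rot: "(\<integral>\<^sup>+x. ennreal (max_incr (\<lambda>l. x ((i + l) mod m)) p) \<partial>gauss_seq) =
      ennreal (incr_moment 1 p)" if "i < m" for i
  proof -
    \<comment> \<open>The rotation of the first m indices, extended by the identity to an injection
      on all indices.\<close>
    define \<rho> where "\<rho> l = (if l < m then (i + l) mod m else l)" for l
    have "inj \<rho>"
    proof (rule injI)
      fix a b assume eq: "\<rho> a = \<rho> b"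
      have lt: "(i + l) mod m < m" for l by (simp add: m_def)
      show "a = b"
      proof (cases "a < m \<and> b < m")
        case True
        have "(i + l) mod m = (if i + l < m then i + l else i + l - m)" if "l < m" for l
          using that \<open>i < m\<close> by (simp add: le_mod_geq)
        then show ?thesis using True eq \<open>i < m\<close> by (auto simp: \<rho>_def split: if_splits)
      next
        case False
        then show ?thesis using eq lt[of a] lt[of b] by (auto simp: \<rho>_def split: if_splits)
      qed
    qed
    have "(\<integral>\<^sup>+x. ennreal (max_incr (\<lambda>l. x ((i + l) mod m)) p) \<partial>gauss_seq) =
        (\<integral>\<^sup>+x. ennreal (max_incr (\<lambda>l. x (\<rho> l)) p) \<partial>gauss_seq)"
      by (intro nn_integral_cong arg_cong[where f=ennreal] max_incr_cong)
        (simp add: \<rho>_def m_def)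
    also have "\<dots> = (\<integral>\<^sup>+x. ennreal (max_incr x p) \<partial>gauss_seq)"
      by (rule nn_integral_reindex_gauss_seq[OF \<open>inj \<rho>\<close>]) simp
    finally show ?thesis using nn_integral_max_incr[of p 1] by simp
  qed
  have [measurable]: "(\<lambda>x. max_incr (\<lambda>l. x ((i + l) mod m)) p) \<in> borel_measurable gauss_seq" for i
    by (rule measurable_compose[OF measurable_reindex_gauss_seq measurable_max_incr])
  have "ennreal (real m * incr_moment 1 p) =
      (\<Sum>i<m. \<integral>\<^sup>+x. ennreal (max_incr (\<lambda>l. x ((i + l) mod m)) p) \<partial>gauss_seq)"
    by (simp add: rot ennreal_mult incr_moment_nonneg ennreal_of_nat_eq_real_of_nat)
  also have "\<dots> = (\<integral>\<^sup>+x. ennreal (max 0 (walk x m)) \<partial>gauss_seq)"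
  proof -
    have "(\<Sum>i<m. ennreal (max_incr (\<lambda>l. x ((i + l) mod m)) p)) = ennreal (max 0 (walk x m))" for x
      using sum_max_incr_rotations[of x p]
      by (subst sum_ennreal) (simp_all only: max_incr_nonneg m_def)
    then show ?thesis
      by (subst nn_integral_sum[symmetric]) auto
  qed
  also have "\<dots> = (\<integral>\<^sup>+t. ennreal (normal_density 0 (sqrt m) t) * ennreal (max 0 t) \<partial>lborel)"
    by (rule distributed_nn_integral[symmetric]) (use distributed_walk[of p] in \<open>simp_all add: m_def\<close>)
  also have "\<dots> = ennreal (sqrt m / sqrt (2 * pi))"
    using nn_integral_pos_part_normal[of "sqrt m"] by (simp add: ennreal_mult m_def)
  finally have "real m * incr_moment 1 p = sqrt m / sqrt (2 * pi)"
    by (simp add: incr_moment_nonneg)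
  then have "incr_moment 1 p = sqrt m / m / sqrt (2 * pi)"
    by (simp add: m_def divide_simps mult_ac)
  also have "sqrt m / m = 1 / sqrt m"
    by (simp add: sqrt_divide_self_eq inverse_eq_divide)
  finally show ?thesis
    by (simp add: m_def[symmetric] real_sqrt_mult mult.commute)
qed

text \<open>Weighted arithmetic-geometric mean inequality for d^r = sqrt (d * d^(2r-1)). The free
  weight s lets the known decay of the first moment carry over to the higher ones.\<close>

lemma incr_moment_le_mix:
  assumes "s > 0" "r > 0"
  shows "incr_moment r j \<le> (incr_moment 1 j / s + s * gauss_abs_moment (2 * r - 1)) / 2"
proof -
  have pw: "d ^ r \<le> (d / s + s * d ^ (2 * r - 1)) / 2" if "d \<ge> 0" for d :: real
  proof (cases "d = 0")
    case True
    then show ?thesis using assms by (simp add: power_0_left)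
  next
    case False
    obtain q where r: "r = Suc q" using assms by (cases r) auto
    define u where "u = d ^ q"
    have u: "d ^ r = d * u" "d ^ (2 * r - 1) = d * u\<^sup>2"
      by (simp_all add: r u_def power_even_eq mult.commute flip: power_mult)
    have "0 \<le> d * (1 - s * u)\<^sup>2 / s" using that assms by simp
    also have "\<dots> = d / s + s * d ^ (2 * r - 1) - 2 * d ^ r"
      unfolding u using assms by (simp add: power2_eq_square field_simps)
    finally show ?thesis by simp
  qed
  have "ennreal (incr_moment r j) \<le>
      (\<integral>\<^sup>+x. ennreal (1 / (2 * s)) * ennreal (max_incr x j ^ 1) +
        ennreal (s / 2) * ennreal (max_incr x j ^ (2 * r - 1)) \<partial>gauss_seq)"
    unfolding nn_integral_max_incr[symmetric] using assms pw[OF max_incr_nonneg]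
    by (intro nn_integral_mono)
      (simp add: max_incr_nonneg field_simps flip: ennreal_mult ennreal_plus)
  also have "\<dots> = ennreal (1 / (2 * s)) * ennreal (incr_moment 1 j) +
        ennreal (s / 2) * ennreal (incr_moment (2 * r - 1) j)"
    by (simp add: nn_integral_add nn_integral_cmult nn_integral_max_incr[of j 1, simplified]
        nn_integral_max_incr)
  also have "\<dots> = ennreal (incr_moment 1 j / (2 * s) + s / 2 * incr_moment (2 * r - 1) j)"
    using assms by (simp add: incr_moment_nonneg flip: ennreal_mult ennreal_plus)
  finally have "incr_moment r j \<le> incr_moment 1 j / (2 * s) + s / 2 * incr_moment (2 * r - 1) j"
    using assms by (subst (asm) ennreal_le_iff) (auto simp: incr_moment_nonneg)
  also have "\<dots> \<le> incr_moment 1 j / (2 * s) + s / 2 * gauss_abs_moment (2 * r - 1)"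
    using assms by (intro add_left_mono mult_left_mono incr_moment_le) auto
  finally show ?thesis by (simp add: field_simps)
qed

section \<open>Convolution with an inverse square root\<close>

lemma has_integral_indicator_Ioc:
  fixes a b :: real
  assumes "0 \<le> a" "a \<le> b" "b \<le> 1"
  shows "((indicator {a<..b} :: real \<Rightarrow> real) has_integral (b - a)) {0<..<1}"
proof -
  have "((\<lambda>_. 1 :: real) has_integral (b - a)) {a..b}"
    using has_integral_const_real[of "1::real" a b] assms by simp
  then have "((\<lambda>x. if x \<in> {a..b} then 1 else 0 :: real) has_integral (b - a)) {0..1}"
    using assms by (subst has_integral_restrict) auto
  then have "((indicator {a<..b} :: real \<Rightarrow> real) has_integral (b - a)) {0..1}"
    by (rule has_integral_spike_finite[of "{a}", rotated 2]) (auto simp: indicator_def)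
  then show ?thesis by (simp add: has_integral_Icc_iff_Ioo)
qed

text \<open>A convergent sequence is bounded. At i = 0 the quotient is 0 by convention and says
  nothing about \<open>g 0\<close>.\<close>

lemma LIMSEQ_powr_bound:
  assumes "(\<lambda>i. g i / real i powr \<alpha>) \<longlonglongrightarrow> (L::real)"
  obtains C where "C \<ge> 0" "\<And>i. i > 0 \<Longrightarrow> \<bar>g i\<bar> \<le> C * real i powr \<alpha>"
proof -
  from assms have "Bseq (\<lambda>i. g i / real i powr \<alpha>)"
    by (intro convergent_imp_Bseq convergentI)
  then obtain C where C: "C > 0" "\<And>i. \<bar>g i / real i powr \<alpha>\<bar> \<le> C"
    unfolding Bseq_def by auto
  have "\<bar>g i\<bar> \<le> C * real i powr \<alpha>" if "i > 0" for i
    using C(2)[of i] that by (simp add: field_simps)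
  with C(1) show ?thesis by (intro that[of C]) auto
qed

text \<open>The sum, suitably normalised, is the integral over \<open>(0,1)\<close> of a step function that converges
  to \<open>L * (1 - x) powr \<alpha> / sqrt x\<close> and is dominated by a multiple of \<open>1 / sqrt x\<close>.\<close>
lemma convolution_inverse_sqrt_limit:
  fixes g :: "nat \<Rightarrow> real"
  assumes "\<alpha> \<ge> 0" and lim: "(\<lambda>i. g i / real i powr \<alpha>) \<longlonglongrightarrow> L"
  shows "(\<lambda>K. (\<Sum>j<K. g (K - j) / sqrt (real (Suc j))) / real K powr (\<alpha> + 1/2))
    \<longlonglongrightarrow> L * Beta (\<alpha> + 1) (1/2)"
proof -
  obtain C where C: "C \<ge> 0" "\<And>i. i > 0 \<Longrightarrow> \<bar>g i\<bar> \<le> C * real i powr \<alpha>"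
    using LIMSEQ_powr_bound[OF lim] by blast
  \<comment> \<open>The height over cell j is K times the j-th normalised summand, to offset the
    cell width 1/K; this is where the 1/2 in the exponent goes.\<close>
  define c where "c K j = g (K - j) / real K powr \<alpha> * sqrt (real K / real (Suc j))" for K j
  define f where "f K x = (\<Sum>j<K. indicator {real j / real K<..real (Suc j) / real K} x * c K j)"
    for K and x :: real
  \<comment> \<open>Index of the cell containing x; cells are open on the left and closed on the
    right, hence ceiling minus one.\<close>
  define J where "J x K = nat \<lceil>real K * x\<rceil> - 1" for x :: real and K :: nat
  have J: "J x K < K" "real (J x K) < real K * x" "real K * x \<le> real (J x K) + 1"
    if "0 < x" "x < 1" "K > 0" for x K
  proof -
    have pos: "0 < real K * x" using that by simp
    then have "nat \<lceil>real K * x\<rceil> \<ge> 1" "real (nat \<lceil>real K * x\<rceil>) = real_of_int \<lceil>real K * x\<rceil>"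
      by linarith+
    then have eq: "real (J x K) = real_of_int \<lceil>real K * x\<rceil> - 1"
      unfolding J_def by (simp add: of_nat_diff)
    show 1: "real (J x K) < real K * x" "real K * x \<le> real (J x K) + 1"
      unfolding eq by linarith+
    have "real K * x < real K" using that by simp
    with 1 show "J x K < K" by linarith
  qed
  have f_eq: "f K x = c K (J x K)" if x: "0 < x" "x < 1" and "K > 0" for x K
  proof -
    have uniq: "j = J x K" if "x \<in> {real j / real K<..real (Suc j) / real K}" for j
    proof -
      have "real j < real K * x" "real K * x \<le> real j + 1"
        using that \<open>K > 0\<close> by (auto simp: field_simps)
      with J[OF x \<open>K > 0\<close>] have "real j < real (J x K) + 1" "real (J x K) < real j + 1"
        by linarith+
      then show ?thesis by linarith
    qed
    have mem: "x \<in> {real (J x K) / real K<..real (Suc (J x K)) / real K}"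
      using J[OF x \<open>K > 0\<close>] \<open>K > 0\<close> by (auto simp: field_simps)
    have "f K x = (\<Sum>j<K. if j = J x K then c K j else 0)"
      unfolding f_def
    proof (rule sum.cong[OF refl])
      fix j
      show "indicator {real j / real K<..real (Suc j) / real K} x * c K j =
          (if j = J x K then c K j else 0)"
      proof (cases "j = J x K")
        case True
        show ?thesis
          unfolding True indicator_simps(1)[OF mem] by simp
      next
        case False
        then have "x \<notin> {real j / real K<..real (Suc j) / real K}"
          using uniq by blast
        then show ?thesis
          unfolding indicator_simps(2) using False by simp
      qed
    qed
    also have "\<dots> = c K (J x K)"
      using J(1)[OF x \<open>K > 0\<close>] by (subst sum.delta) (simp_all only: finite_lessThan lessThan_iff if_True)
    finally show ?thesis .
  qed
  have int_f: "(f K has_integral (\<Sum>j<K. 1 / real K * c K j)) {0<..<1}" for K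
    unfolding f_def
  proof (intro has_integral_sum has_integral_mult_left finite_lessThan)
    fix j assume "j \<in> {..<K}"
    then have "real (Suc j) / real K - real j / real K = 1 / real K"
        "0 \<le> real j / real K" "real j / real K \<le> real (Suc j) / real K" "real (Suc j) / real K \<le> 1"
      by (auto simp: divide_simps)
    with has_integral_indicator_Ioc[of "real j / real K" "real (Suc j) / real K"]
    show "((indicator {real j / real K<..real (Suc j) / real K} :: real \<Rightarrow> real)
        has_integral 1 / real K) {0<..<1}"
      by simp
  qed
  have powr_neg_half: "t powr (1/2 - 1) = 1 / sqrt t" if "t \<in> {0<..<1}" for t :: real
    using powr_minus_divide[of t "1/2"] that by (simp add: powr_half_sqrt)
  \<comment> \<open>Integrability of the dominating function is read off the Beta integral with
    second parameter 1.\<close>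
  have "((\<lambda>t. C * (t powr (1/2 - 1) * (1 - t) powr (1 - 1))) has_integral C * Beta (1/2) 1) {0<..<1}"
    using has_integral_Beta_real[of "1/2" 1, unfolded has_integral_Icc_iff_Ioo]
    by (intro has_integral_mult_right) simp
  then have "(\<lambda>t. C * (t powr (1/2 - 1) * (1 - t) powr (1 - 1))) integrable_on {0<..<1}"
    by blast
  then have int_h: "(\<lambda>t. C / sqrt t) integrable_on {0<..<1}"
    by (rule integrable_spike_finite[of "{}", rotated 2])
      (auto simp only: powr_neg_half, auto)
  have bound: "norm (f K x) \<le> C / sqrt x" if "x \<in> {0<..<1}" for K x
  proof (cases "K = 0")
    case True
    then show ?thesis using C(1) that by (simp add: f_def)
  next
    case False
    then have K: "K > 0" by simp
    have x: "0 < x" "x < 1" using that by auto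
    define j where "j = J x K"
    have j: "j < K" "real K * x \<le> real j + 1"
      using J[OF x K] by (simp_all add: j_def)
    have "\<bar>g (K - j)\<bar> \<le> C * real (K - j) powr \<alpha>"
      using C(2)[of "K - j"] j by simp
    also have "\<dots> \<le> C * real K powr \<alpha>"
      using C(1) assms(1) by (intro mult_left_mono powr_mono2) auto
    finally have "\<bar>g (K - j)\<bar> / real K powr \<alpha> \<le> C"
      using K by (simp add: field_simps)
    \<comment> \<open>As x is at most the right end (j + 1)/K of its cell, the index shift in
      \<open>Suc j\<close> keeps the step function below the singularity at 0.\<close>
    moreover have "sqrt (real K / real (Suc j)) \<le> 1 / sqrt x"
    proof -
      have "real K / real (Suc j) \<le> 1 / x"
        using j x by (simp add: field_simps)
      then have "sqrt (real K / real (Suc j)) \<le> sqrt (1 / x)"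
        by (rule real_sqrt_le_mono)
      then show ?thesis by (simp add: real_sqrt_divide)
    qed
    ultimately have "\<bar>g (K - j)\<bar> / real K powr \<alpha> * sqrt (real K / real (Suc j)) \<le> C * (1 / sqrt x)"
      using C(1) by (intro mult_mono) auto
    then show ?thesis
      using f_eq[OF x K] by (simp add: c_def j_def[symmetric] abs_mult)
  qed
  have conv: "(\<lambda>K. f K x) \<longlonglongrightarrow> L * ((1 - x) powr \<alpha> * (1 / sqrt x))" if "x \<in> {0<..<1}" for x
  proof -
    have x: "0 < x" "x < 1" using that by auto
    have ev: "\<forall>\<^sub>F K in sequentially. K > (0::nat)"
      by (rule eventually_gt_at_top)
    have jK: "(\<lambda>K. real (J x K) / real K) \<longlonglongrightarrow> x"
    proof (rule tendsto_sandwich)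
      show "\<forall>\<^sub>F K in sequentially. x - 1 / real K \<le> real (J x K) / real K"
        using ev
      proof eventually_elim
        case (elim K)
        then have "x \<le> (real (J x K) + 1) / real K"
          using J(3)[OF x elim] by (simp add: pos_le_divide_eq mult.commute)
        then show ?case by (simp add: add_divide_distrib)
      qed
      show "\<forall>\<^sub>F K in sequentially. real (J x K) / real K \<le> x"
        using ev
      proof eventually_elim
        case (elim K)
        then show ?case
          using J(2)[OF x elim] by (simp add: pos_divide_le_eq mult.commute)
      qed
      show "(\<lambda>K. x - 1 / real K) \<longlonglongrightarrow> x"
        using tendsto_diff[OF tendsto_const lim_1_over_n] by simp
    qed simp
    have frac: "(\<lambda>K. real (K - J x K) / real K) \<longlonglongrightarrow> 1 - x"
    proof (rule Lim_transform_eventually)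
      show "(\<lambda>K. 1 - real (J x K) / real K) \<longlonglongrightarrow> 1 - x"
        by (intro tendsto_intros jK)
      show "\<forall>\<^sub>F K in sequentially. 1 - real (J x K) / real K = real (K - J x K) / real K"
        using ev by eventually_elim (use J(1)[OF x] in \<open>auto simp: field_simps of_nat_diff less_imp_le\<close>)
    qed
    \<comment> \<open>Since x < 1, the argument of \<open>g\<close> grows linearly in K, so the
      asymptotics of \<open>g\<close> apply.\<close>
    have inf: "filterlim (\<lambda>K. K - J x K) at_top sequentially"
    proof -
      have "filterlim (\<lambda>K. real (K - J x K) / real K * real K) at_top sequentially"
        using x by (intro filterlim_tendsto_pos_mult_at_top[OF frac] filterlim_real_sequentially) auto
      moreover have "\<forall>\<^sub>F K in sequentially. real (K - J x K) / real K * real K = real (K - J x K)"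
        using ev by eventually_elim auto
      ultimately have "filterlim (\<lambda>K. real (K - J x K)) at_top sequentially"
        by (subst (asm) filterlim_cong[OF refl refl])
      then show ?thesis
        by (simp add: filterlim_sequentially_iff_filterlim_real)
    qed
    have sq: "(\<lambda>K. real (Suc (J x K)) / real K) \<longlonglongrightarrow> x"
      using tendsto_add[OF jK lim_1_over_n] by (simp add: add_divide_distrib add.commute)
    have "(\<lambda>K. g (K - J x K) / real (K - J x K) powr \<alpha> *
        ((real (K - J x K) / real K) powr \<alpha> * (1 / sqrt (real (Suc (J x K)) / real K))))
      \<longlonglongrightarrow> L * ((1 - x) powr \<alpha> * (1 / sqrt x))"
      using x by (intro tendsto_intros filterlim_compose[OF lim inf] frac sq) auto
    moreover have "\<forall>\<^sub>F K in sequentially. g (K - J x K) / real (K - J x K) powr \<alpha> *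
        ((real (K - J x K) / real K) powr \<alpha> * (1 / sqrt (real (Suc (J x K)) / real K))) = f K x"
      using ev
    proof eventually_elim
      case (elim K)
      then have "real (K - J x K) > 0" using J(1)[OF x] by simp
      with elim show ?case
        by (simp add: f_eq[OF x] c_def powr_divide real_sqrt_divide)
    qed
    ultimately show ?thesis by (rule Lim_transform_eventually)
  qed
  have "((\<lambda>t. L * (t powr (1/2 - 1) * (1 - t) powr (\<alpha> + 1 - 1))) has_integral L * Beta (1/2) (\<alpha> + 1)) {0<..<1}"
    using has_integral_Beta_real[of "1/2" "\<alpha> + 1", unfolded has_integral_Icc_iff_Ioo] assms(1)
    by (intro has_integral_mult_right) simp
  then have "((\<lambda>t. L * ((1 - t) powr \<alpha> * (1 / sqrt t))) has_integral L * Beta (1/2) (\<alpha> + 1)) {0<..<1}"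
    by (rule has_integral_spike_finite[of "{}", rotated 2])
      (auto simp only: powr_neg_half, auto simp: mult.commute)
  then have "integral {0<..<1} (\<lambda>t. L * ((1 - t) powr \<alpha> * (1 / sqrt t))) = L * Beta (\<alpha> + 1) (1/2)"
    by (simp add: integral_unique Beta_commute)
  moreover have "(\<lambda>K. integral {0<..<1} (f K)) \<longlonglongrightarrow>
      integral {0<..<1} (\<lambda>t. L * ((1 - t) powr \<alpha> * (1 / sqrt t)))"
    by (rule dominated_convergence(2)[OF has_integral_integrable[OF int_f] int_h bound conv])
  moreover have "integral {0<..<1} (f K) =
      (\<Sum>j<K. g (K - j) / sqrt (real (Suc j))) / real K powr (\<alpha> + 1/2)" for K
  proof (cases "K = 0")
    case False
    then have "real K powr (\<alpha> + 1/2) = real K powr \<alpha> * sqrt (real K)"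
      by (simp add: powr_add powr_half_sqrt)
    moreover have "sqrt (real K) * sqrt (real K) = real K" by simp
    ultimately have "1 / real K * c K j = g (K - j) / sqrt (real (Suc j)) / real K powr (\<alpha> + 1/2)" for j
      unfolding c_def real_sqrt_divide using False
      by (simp add: divide_simps del: real_sqrt_mult_self of_nat_Suc)
    then show ?thesis
      unfolding integral_unique[OF int_f] sum_divide_distrib by simp
  qed (simp add: f_def[abs_def])
  ultimately show ?thesis by simp
qed

section \<open>Asymptotics of the moments of the area\<close>

lemma sum_inverse_sqrt_le: "(\<Sum>j<K. 1 / sqrt (real (Suc j))) \<le> 2 * sqrt (real K)"
proof (induction K)
  case (Suc K)
  define a b where "a = sqrt (real K)" and "b = sqrt (real (Suc K))"
  have ab: "a \<ge> 0" "b > 0" "b\<^sup>2 = a\<^sup>2 + 1" by (simp_all add: a_def b_def)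
  have "0 \<le> (b - a)\<^sup>2" by simp
  then have "1 / b \<le> 2 * b - 2 * a"
    using ab by (simp add: field_simps power2_eq_square)
  with Suc show ?case by (simp add: a_def b_def)
qed simp

lemma incr_moment_mean_tendsto_0:
  assumes "r > 0"
  shows "(\<lambda>K. (\<Sum>j<K. incr_moment r j) / real K) \<longlonglongrightarrow> 0"
proof (rule tendsto_sandwich)
  define c where "c = gauss_abs_moment (2 * r - 1)"
  show "\<forall>\<^sub>F K in sequentially. 0 \<le> (\<Sum>j<K. incr_moment r j) / real K"
    by (simp add: sum_nonneg incr_moment_nonneg)
  show "\<forall>\<^sub>F K in sequentially. (\<Sum>j<K. incr_moment r j) / real K \<le>
      (1 / sqrt (2 * pi) + c / 2) * real K powr (-1/4)"
    using eventually_gt_at_top[of 0]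
  proof eventually_elim
    case (elim K)
    \<comment> \<open>Balances the two parts of the mixed bound, which after averaging have orders
      K^(-1/2) / s and s.\<close>
    define s where "s = real K powr (-1/4)"
    have s: "s > 0" "sqrt (real K) / s = real K * s"
      using elim powr_add[of "real K" 1 "-1/4"]
      by (simp_all add: s_def flip: powr_half_sqrt powr_diff)
    have "(\<Sum>j<K. incr_moment r j) \<le> (\<Sum>j<K. (incr_moment 1 j / s + s * c) / 2)"
      unfolding c_def by (intro sum_mono incr_moment_le_mix s assms)
    also have "\<dots> = (\<Sum>j<K. 1 / sqrt (real (Suc j))) / (2 * s * sqrt (2 * pi)) + real K * s * c / 2"
      unfolding incr_moment_1
      by (simp add: real_sqrt_mult sum.distrib sum_divide_distrib add_divide_distrib
          mult_ac del: of_nat_Suc)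
    also have "\<dots> \<le> 2 * sqrt (real K) / (2 * s * sqrt (2 * pi)) + real K * s * c / 2"
      using s by (intro add_right_mono divide_right_mono sum_inverse_sqrt_le) auto
    also have "\<dots> = (sqrt (real K) / s) / sqrt (2 * pi) + real K * s * c / 2"
      by simp
    also have "\<dots> = real K * ((1 / sqrt (2 * pi) + c / 2) * s)"
      unfolding s(2) by (simp add: algebra_simps)
    finally show ?case
      using elim by (simp add: s_def field_simps)
  qed
  have "(\<lambda>K. real K powr (-1/4)) \<longlonglongrightarrow> 0"
    by (intro tendsto_neg_powr filterlim_real_sequentially) simp
  from tendsto_mult_right_zero[OF this]
  show "(\<lambda>K. (1 / sqrt (2 * pi) + c / 2) * real K powr (-1/4)) \<longlonglongrightarrow> 0" .
qed simp

text \<open>The limit of the r = 1 term of the recursion: \<open>Suc n\<close> is the binomial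
  coefficient, the Beta value comes from the convolution, and 1 / sqrt (2 pi) from the mean
  increment.\<close>

fun area_const :: "nat \<Rightarrow> real" where
  "area_const 0 = 1"
| "area_const (Suc n) =
    real (Suc n) * (area_const n * Beta (3 * real n / 2 + 2) (1/2) / sqrt (2 * pi))"

text \<open>In the Beta value, Gamma(3n/2 + 2) = (3n/2 + 1) Gamma(3n/2 + 1) cancels the old
  denominator. Writing 3n/2 + 1 = (3/2)(n + 2/3) turns Gamma(n + 2/3) into Gamma(n + 1 + 2/3), which
  is the origin of the 2/3. What remains, (3/2) sqrt pi / sqrt (2 pi), equals 3 sqrt 2 / 4.\<close>

lemma area_const_eq:
  "area_const n = fact n * Gamma (real n + 2/3) / (Gamma (2/3) * Gamma (3 * real n / 2 + 1))
     * (3 * sqrt 2 / 4) ^ n"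
proof (induction n)
  case 0
  then show ?case by (simp add: Gamma_real_pos_exp)
next
  case (Suc n)
  define G where "G = Gamma (3 * real n / 2 + 1)"
  define H where "H = Gamma (3 * real (Suc n) / 2 + 1)"
  define Q where "Q = Gamma (real n + 2/3)"
  define P where "P = Gamma (2/3 :: real)"
  have pos: "G > 0" "H > 0" "Q > 0" "P > 0"
    unfolding G_def H_def Q_def P_def by (rule Gamma_real_pos; simp add: add_nonneg_pos)+
  have "Gamma (3 * real n / 2 + 1 + 1) = (3 * real n / 2 + 1) * G"
    unfolding G_def by (rule Gamma_plus1) (auto elim!: nonpos_Ints_cases)
  then have G2: "Gamma (3 * real n / 2 + 2) = (3 * real n / 2 + 1) * G"
    by (simp add: add.assoc)
  have "Gamma (real n + 2/3 + 1) = (real n + 2/3) * Q"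
    unfolding Q_def by (rule Gamma_plus1) (auto elim!: nonpos_Ints_cases)
  then have Q2: "Gamma (real (Suc n) + 2/3) = (real n + 2/3) * Q"
    by (simp add: add_ac)
  have "Beta (3 * real n / 2 + 2) (1/2) = (3 * real n / 2 + 1) * G * sqrt pi / H"
    unfolding Beta_def G2 Gamma_one_half_real H_def by (simp add: field_simps)
  then have "area_const (Suc n) = real (Suc n) * (area_const n *
      ((3 * real n / 2 + 1) * G / H) / sqrt 2)"
    by (simp add: real_sqrt_mult)
  also have "\<dots> = real (Suc n) * (fact n * Q / (P * G) * (3 * sqrt 2 / 4) ^ n *
      ((3 * real n / 2 + 1) * G / H) / sqrt 2)"
    unfolding Suc.IH G_def Q_def P_def ..
  also have "\<dots> = real (Suc n) * fact n * ((3 * real n / 2 + 1) * Q) / (P * H) *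
      (3 * sqrt 2 / 4) ^ n / sqrt 2"
    using pos by (simp add: field_simps)
  also have "1 / sqrt 2 = sqrt 2 / (2::real)"
    by (simp add: field_simps)
  then have "real (Suc n) * fact n * ((3 * real n / 2 + 1) * Q) / (P * H) *
      (3 * sqrt 2 / 4) ^ n / sqrt 2 = real (Suc n) * fact n * ((3 * real n / 2 + 1) * Q) / (P * H) *
      (3 * sqrt 2 / 4) ^ n * (sqrt 2 / 2)"
    by (simp only: divide_inverse mult_1)
  also have "\<dots> = real (Suc n) * fact n * ((real n + 2/3) * Q) / (P * H) * (3 * sqrt 2 / 4) ^ Suc n"
    using pos by (simp add: field_simps)
  finally show ?case
    by (simp only: Q2 H_def P_def fact_Suc of_nat_mult of_nat_fact)
qed

lemma area_moment_limit: "(\<lambda>K. area_moment n K / real K powr (3 * real n / 2)) \<longlonglongrightarrow> area_const n"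
proof (induction n rule: less_induct)
  case (less n)
  show ?case
  proof (cases n)
    case 0
    have "\<forall>\<^sub>F K in sequentially. 1 = area_moment n K / real K powr (3 * real n / 2)"
      using eventually_gt_at_top[of 0] by eventually_elim (simp add: 0 area_moment_0)
    from Lim_transform_eventually[OF tendsto_const this] show ?thesis by (simp add: 0)
  next
    case (Suc m)
    define T where "T r K = (\<Sum>j<K. real (K - j) ^ r * area_moment (n - r) (K - j) * incr_moment r j)"
      for r K
    have rec: "area_moment n (Suc K) = (\<Sum>r=1..n. real (n choose r) * T r K)" for K
      unfolding T_def sum_distrib_left
      by (subst area_moment_Suc, simp add: Suc, subst sum.swap) (simp add: mult_ac)
    have T1: "(\<lambda>K. T 1 K / real K powr (3 * real n / 2)) \<longlonglongrightarrow>
        area_const m * Beta (3 * real m / 2 + 2) (1/2) / sqrt (2 * pi)"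
    proof -
      have "(\<lambda>i. real i * area_moment m i / real i powr (3 * real m / 2 + 1)) \<longlonglongrightarrow> area_const m"
      proof (rule Lim_transform_eventually)
        show "(\<lambda>K. area_moment m K / real K powr (3 * real m / 2)) \<longlonglongrightarrow> area_const m"
          using less.IH[of m] Suc by simp
        show "\<forall>\<^sub>F i in sequentially. area_moment m i / real i powr (3 * real m / 2) =
            real i * area_moment m i / real i powr (3 * real m / 2 + 1)"
          using eventually_gt_at_top[of 0] by eventually_elim (simp add: powr_add)
      qed
      \<comment> \<open>Here \<alpha> = 3m/2 + 1, where the 1 comes from the factor K - j; the 1/2
        gained by the convolution completes 3n/2.\<close>
      from convolution_inverse_sqrt_limit[OF _ this]
      have "(\<lambda>K. (\<Sum>j<K. real (K - j) * area_moment m (K - j) / sqrt (real (Suc j))) /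
          real K powr (3 * real m / 2 + 1 + 1 / 2) / sqrt (2 * pi)) \<longlonglongrightarrow>
          area_const m * Beta (3 * real m / 2 + 1 + 1) (1/2) / sqrt (2 * pi)"
        by (intro tendsto_divide tendsto_const) auto
      moreover have "3 * real m / 2 + 1 + 1 / 2 = 3 * real n / 2"
        by (simp add: Suc field_simps)
      moreover have "3 * real m / 2 + 1 + 1 = 3 * real m / 2 + 2" by simp
      moreover have "T 1 K = (\<Sum>j<K. real (K - j) * area_moment m (K - j) / sqrt (real (Suc j))) /
          sqrt (2 * pi)" for K
        unfolding T_def sum_divide_distrib incr_moment_1 by (simp add: Suc real_sqrt_mult mult_ac del: of_nat_Suc)
      ultimately show ?thesis by (simp only: divide_divide_eq_left mult.commute)
    qed
    have T2: "(\<lambda>K. T r K / real K powr (3 * real n / 2)) \<longlonglongrightarrow> 0" if r: "2 \<le> r" "r \<le> n" for r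
    proof -
      obtain C where C: "C \<ge> 0"
        "\<And>i. i > 0 \<Longrightarrow> \<bar>area_moment (n - r) i\<bar> \<le> C * real i powr (3 * real (n - r) / 2)"
        using LIMSEQ_powr_bound[OF less.IH[of "n - r"]] r by auto
      have lim: "(\<lambda>K. C * ((\<Sum>j<K. incr_moment r j) / real K)) \<longlonglongrightarrow> 0"
        using tendsto_mult_right_zero[OF incr_moment_mean_tendsto_0] r by simp
      show ?thesis
      proof (rule tendsto_sandwich[OF _ _ tendsto_const lim])
        show "\<forall>\<^sub>F K in sequentially. 0 \<le> T r K / real K powr (3 * real n / 2)"
          unfolding T_def by (intro always_eventually allI divide_nonneg_nonneg sum_nonneg
              mult_nonneg_nonneg incr_moment_nonneg area_moment_nonneg) auto
        show "\<forall>\<^sub>F K in sequentially. T r K / real K powr (3 * real n / 2) \<le>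
            C * ((\<Sum>j<K. incr_moment r j) / real K)"
          using eventually_gt_at_top[of 0]
        proof eventually_elim
          case (elim K)
          define \<beta> where "\<beta> = real r + 3 * real (n - r) / 2"
          \<comment> \<open>\<beta> = 3n/2 - r/2, with equality in the first bound at r = 2: there
            power counting yields no decay, and the vanishing average of the increment moments is
            essential.\<close>
          have \<beta>: "\<beta> + 1 \<le> 3 * real n / 2" "0 \<le> \<beta>"
            using r by (simp_all add: \<beta>_def of_nat_diff field_simps)
          have "real (K - j) ^ r * area_moment (n - r) (K - j) \<le> C * real K powr \<beta>" if "j < K" for j
          proof -
            have "real (K - j) ^ r * area_moment (n - r) (K - j) \<le>
                real (K - j) ^ r * (C * real (K - j) powr (3 * real (n - r) / 2))"
              using C(2)[of "K - j"] that by (intro mult_left_mono) auto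
            also have "\<dots> = C * real (K - j) powr \<beta>"
              using that by (simp add: \<beta>_def powr_add powr_realpow)
            also have "\<dots> \<le> C * real K powr \<beta>"
              using C(1) \<beta> by (intro mult_left_mono powr_mono2) auto
            finally show ?thesis .
          qed
          then have "T r K \<le> (\<Sum>j<K. C * real K powr \<beta> * incr_moment r j)"
            unfolding T_def by (intro sum_mono mult_right_mono incr_moment_nonneg) auto
          also have "\<dots> = C * ((\<Sum>j<K. incr_moment r j) / real K) * real K powr (\<beta> + 1)"
            using elim by (simp add: powr_add sum_distrib_left[symmetric])
          also have "\<dots> \<le> C * ((\<Sum>j<K. incr_moment r j) / real K) * real K powr (3 * real n / 2)"
            using C(1) \<beta> elim
            by (intro mult_left_mono powr_mono) (auto intro!: mult_nonneg_nonneg divide_nonneg_nonneg sum_nonneg incr_moment_nonneg)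
          finally show ?case
            using elim by (simp add: divide_le_eq)
        qed
      qed
    qed
    have "(\<lambda>K. \<Sum>r=1..n. real (n choose r) * (T r K / real K powr (3 * real n / 2))) \<longlonglongrightarrow>
        (\<Sum>r=1..n. real (n choose r) * (if r = 1
          then area_const m * Beta (3 * real m / 2 + 2) (1/2) / sqrt (2 * pi) else 0))"
      using T1 T2 by (intro tendsto_sum tendsto_mult tendsto_const) auto
    moreover have "(\<Sum>r=1..n. real (n choose r) * (if r = 1
          then area_const m * Beta (3 * real m / 2 + 2) (1/2) / sqrt (2 * pi) else 0)) = area_const n"
      by (subst sum.remove[of _ 1]) (auto simp: Suc intro!: sum.neutral)
    ultimately have "(\<lambda>K. area_moment n (Suc K) / real K powr (3 * real n / 2)) \<longlonglongrightarrow> area_const n"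
      by (simp add: rec sum_divide_distrib)
    \<comment> \<open>The recursion yields the moment at \<open>Suc K\<close> normalised by a power
      of K; this factor corrects the normalisation.\<close>
    moreover have "(\<lambda>K. (real K / real (Suc K)) powr (3 * real n / 2)) \<longlonglongrightarrow> 1 powr (3 * real n / 2)"
      by (intro tendsto_powr LIMSEQ_n_over_Suc_n tendsto_const) auto
    ultimately have "(\<lambda>K. area_moment n (Suc K) / real K powr (3 * real n / 2) *
        (real K / real (Suc K)) powr (3 * real n / 2)) \<longlonglongrightarrow> area_const n * 1"
      by (intro tendsto_mult) auto
    moreover have "\<forall>\<^sub>F K in sequentially. area_moment n (Suc K) / real K powr (3 * real n / 2) *
        (real K / real (Suc K)) powr (3 * real n / 2) =
        area_moment n (Suc K) / real (Suc K) powr (3 * real n / 2)"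
      using eventually_gt_at_top[of 0] by eventually_elim (simp add: powr_divide)
    ultimately have "(\<lambda>K. area_moment n (Suc K) / real (Suc K) powr (3 * real n / 2)) \<longlonglongrightarrow> area_const n"
      using Lim_transform_eventually by fastforce
    then show ?thesis by (rule LIMSEQ_imp_Suc)
  qed
qed

section \<open>From Brownian motion to the Gaussian walk\<close>

lemma nn_integral_iid_gauss:
  assumes M: "prob_space M" and "N > 0"
    and indep: "prob_space.indep_vars M (\<lambda>_. borel) Y {..<N}"
    and law: "\<And>i. i < N \<Longrightarrow> distr M borel (Y i) = gauss"
    and f [measurable]: "f \<in> borel_measurable gauss_seq"
    and cong: "\<And>x y. (\<And>i. i < N \<Longrightarrow> x i = y i) \<Longrightarrow> f x = f y"
  shows "(\<integral>\<^sup>+\<omega>. f (\<lambda>i. Y i \<omega>) \<partial>M) = (\<integral>\<^sup>+x. f x \<partial>gauss_seq)"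
proof -
  interpret prob_space M by fact
  \<comment> \<open>Padding by zeros turns N entries into a sequence; by \<open>cong\<close> the
    padding does not affect \<open>f\<close>, so only the joint law of the first N entries has to be
    compared.\<close>
  define ext where "ext y i = (if i < N then y i else 0)" for y :: "nat \<Rightarrow> real" and i
  let ?G = "PiM {..<N} (\<lambda>_. gauss)"
  have Y: "random_variable borel (Y i)" if "i < N" for i
    using indep that by (auto simp: indep_vars_def)
  have ext [measurable]: "ext \<in> ?G \<rightarrow>\<^sub>M gauss_seq"
  proof (rule measurable_PiM_single')
    fix i show "(\<lambda>y. ext y i) \<in> ?G \<rightarrow>\<^sub>M gauss"
      unfolding ext_def
      by (cases "i < N") (auto intro!: measurable_component_singleton)
  qed auto
  have restr [measurable]: "(\<lambda>x. \<lambda>i\<in>{..<N}. x i) \<in> gauss_seq \<rightarrow>\<^sub>M ?G"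
    by (intro measurable_restrict measurable_component_singleton) auto
  have Yr [measurable]: "(\<lambda>\<omega>. \<lambda>i\<in>{..<N}. Y i \<omega>) \<in> M \<rightarrow>\<^sub>M ?G"
    by (intro measurable_restrict) (auto simp: measurable_cong_sets[OF refl sets_gauss] intro: Y)
  have "distr M (PiM {..<N} (\<lambda>_. borel)) (\<lambda>\<omega>. \<lambda>i\<in>{..<N}. Y i \<omega>) = PiM {..<N} (\<lambda>i. distr M borel (Y i))"
    using indep Y \<open>N > 0\<close> by (subst (asm) indep_vars_iff_distr_eq_PiM') auto
  also have "\<dots> = ?G"
    by (intro PiM_cong) (auto simp: law)
  finally have 1: "distr M ?G (\<lambda>\<omega>. \<lambda>i\<in>{..<N}. Y i \<omega>) = ?G"
    by (subst distr_cong[OF refl sets_PiM_cong[OF refl sets_gauss] refl]) auto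
  have 2: "distr gauss_seq ?G (\<lambda>x. \<lambda>i\<in>{..<N}. x i) = ?G"
    using distr_PiM_reindex[of UNIV "\<lambda>_. gauss" "\<lambda>i. i" "{..<N}"] prob_space_gauss by simp
  have "(\<integral>\<^sup>+\<omega>. f (\<lambda>i. Y i \<omega>) \<partial>M) = (\<integral>\<^sup>+\<omega>. f (ext (\<lambda>i\<in>{..<N}. Y i \<omega>)) \<partial>M)"
    by (intro nn_integral_cong cong) (simp add: ext_def)
  also have "\<dots> = (\<integral>\<^sup>+y. f (ext y) \<partial>distr M ?G (\<lambda>\<omega>. \<lambda>i\<in>{..<N}. Y i \<omega>))"
    by (subst nn_integral_distr) auto
  also have "\<dots> = (\<integral>\<^sup>+y. f (ext y) \<partial>distr gauss_seq ?G (\<lambda>x. \<lambda>i\<in>{..<N}. x i))"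
    by (simp only: 1 2)
  also have "\<dots> = (\<integral>\<^sup>+x. f (ext (\<lambda>i\<in>{..<N}. x i)) \<partial>gauss_seq)"
    by (subst nn_integral_distr) auto
  also have "\<dots> = (\<integral>\<^sup>+x. f x \<partial>gauss_seq)"
    by (intro nn_integral_cong cong) (simp add: ext_def)
  finally show ?thesis .
qed

definition path_incr :: "nat \<Rightarrow> (real \<Rightarrow> real) \<Rightarrow> nat \<Rightarrow> real" where
  "path_incr N b i = b (real (Suc i) / real N) - b (real i / real N)"

text \<open>When \<open>b 0 = 0\<close>, the left Riemann sum of mesh 1/N for the running maximum of
  \<open>b\<close> over grid points.\<close>

definition grid_area :: "nat \<Rightarrow> (real \<Rightarrow> real) \<Rightarrow> real" where
  "grid_area N b = walk_area (path_incr N b) N / real N"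

lemma walk_path_incr: "b 0 = 0 \<Longrightarrow> walk (path_incr N b) k = b (real k / real N)"
  unfolding walk_def path_incr_def by (subst sum_lessThan_telescope) simp

lemma walk_max_path_incr:
  "b 0 = 0 \<Longrightarrow> walk_max (path_incr N b) k = Max ((\<lambda>j. b (real j / real N)) ` {..k})"
  unfolding walk_max_eq_Max using walk_path_incr by (metis (no_types, lifting) image_cong)

text \<open>Brownian scaling: increments over time 1/N become standard normal when multiplied by
  sqrt N. Together with the mesh 1/N this gives a factor N^(3/2) per power of the area.\<close>

lemma nn_integral_grid_area:
  assumes BM: "standard_brownian_motion M B" and "N > 0"
  shows "(\<integral>\<^sup>+\<omega>. ennreal (grid_area N (\<lambda>t. B t \<omega>) ^ n) \<partial>M) =
    ennreal (area_moment n N / real N powr (3 * real n / 2))"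
proof -
  interpret prob_space M
    using BM by (simp add: standard_brownian_motion_def)
  define ts where "ts i = real i / real N" for i
  define X where "X i \<omega> = B (ts (Suc i)) \<omega> - B (ts i) \<omega>" for i \<omega>
  have "0 \<le> ts 0 \<and> (\<forall>i<N. ts i < ts (Suc i))"
    using \<open>N > 0\<close> by (simp add: ts_def divide_strict_right_mono)
  then have indep: "indep_vars (\<lambda>_. borel) X {..<N}"
    and dist: "\<And>i. i < N \<Longrightarrow> distributed M lborel (X i)
      (\<lambda>x. ennreal (normal_density 0 (sqrt (ts (Suc i) - ts i)) x))"
    using BM unfolding standard_brownian_motion_def X_def by blast+
  define Y where "Y i \<omega> = sqrt (real N) * X i \<omega>" for i \<omega>
  have indepY: "indep_vars (\<lambda>_. borel) Y {..<N}"
    unfolding Y_def by (rule indep_vars_compose2[OF indep]) simp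
  have lawY: "distr M borel (Y i) = gauss" if "i < N" for i
  proof -
    have "ts (Suc i) - ts i = 1 / real N"
      by (simp add: ts_def divide_simps)
    with dist[OF that] have "distributed M lborel (X i) (normal_density 0 (1 / sqrt (real N)))"
      by (simp add: real_sqrt_divide)
    then have "distributed M lborel (\<lambda>\<omega>. 0 + sqrt (real N) * X i \<omega>)
        (normal_density (0 + sqrt (real N) * 0) (\<bar>sqrt (real N)\<bar> * (1 / sqrt (real N))))"
      using \<open>N > 0\<close> by (intro normal_density_affine) auto
    then have "distributed M lborel (Y i) (normal_density 0 1)"
      using \<open>N > 0\<close> by (simp add: Y_def[abs_def])
    then show ?thesis
      by (auto simp: distributed_def gauss_def distr_cong[OF refl sets_lborel[symmetric]])
  qed
  define c where "c = 1 / real N powr (3 * real n / 2)"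
  have c: "c \<ge> 0" by (simp add: c_def)
  have "grid_area N (\<lambda>t. B t \<omega>) ^ n =
      c * walk_area (\<lambda>i. Y i \<omega>) N ^ n" for \<omega>
  proof -
    have "sqrt (real N) * real N = real N powr (3 / 2)"
      using powr_add[of "real N" 1 "1/2"] \<open>N > 0\<close> by (simp add: powr_half_sqrt mult.commute)
    then have "(sqrt (real N) * real N) ^ n = real N powr (3 * real n / 2)"
      using \<open>N > 0\<close> by (simp add: powr_powr flip: powr_realpow)
    moreover have "walk_area (\<lambda>i. Y i \<omega>) N = sqrt (real N) * walk_area (path_incr N (\<lambda>t. B t \<omega>)) N"
      unfolding Y_def X_def ts_def path_incr_def by (rule walk_area_scale) simp
    then have "grid_area N (\<lambda>t. B t \<omega>) = walk_area (\<lambda>i. Y i \<omega>) N / (sqrt (real N) * real N)"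
      using \<open>N > 0\<close> by (simp add: grid_area_def)
    ultimately show ?thesis
      by (simp add: c_def power_divide)
  qed
  then have "(\<integral>\<^sup>+\<omega>. ennreal (grid_area N (\<lambda>t. B t \<omega>) ^ n) \<partial>M) =
      (\<integral>\<^sup>+\<omega>. ennreal (c * walk_area (\<lambda>i. Y i \<omega>) N ^ n) \<partial>M)"
    by simp
  also have "\<dots> = (\<integral>\<^sup>+x. ennreal (c * walk_area x N ^ n) \<partial>gauss_seq)"
    by (rule nn_integral_iid_gauss[OF prob_space_axioms \<open>N > 0\<close> indepY lawY])
      (assumption, simp, metis (no_types, lifting) walk_area_cong)
  also have "\<dots> = ennreal c * ennreal (area_moment n N)"
    by (simp add: c ennreal_mult' nn_integral_cmult nn_integral_walk_area)
  also have "\<dots> = ennreal (area_moment n N / real N powr (3 * real n / 2))"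
    using c by (simp add: c_def area_moment_nonneg flip: ennreal_mult)
  finally show ?thesis .
qed

section \<open>Grid areas: refinement and convergence\<close>

lemma sum_lessThan_double:
  fixes f :: "nat \<Rightarrow> 'a::comm_monoid_add"
  shows "(\<Sum>k<2 * n. f k) = (\<Sum>k<n. f (2 * k) + f (2 * k + 1))"
  by (induction n) (simp_all add: add_ac)

lemma grid_area_nonneg: "0 \<le> grid_area N b"
  by (simp add: grid_area_def walk_area_nonneg)

text \<open>The coarse grid is contained in the fine one, so on both halves of a coarse cell the
  fine maximum is at least the coarse one. Such nesting is the reason for dyadic grids.\<close>

lemma grid_area_double:
  assumes "b 0 = 0"
  shows "grid_area N b \<le> grid_area (2 * N) b"
proof -
  let ?w = "\<lambda>N. walk_max (path_incr N b)"
  have le: "?w N k \<le> ?w (2 * N) l" if "2 * k \<le> l" for k l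
    unfolding walk_max_path_incr[where b=b, OF assms]
  proof (rule Max.boundedI)
    fix y assume "y \<in> (\<lambda>j. b (real j / real N)) ` {..k}"
    then obtain j where j: "j \<le> k" "y = b (real (2 * j) / real (2 * N))" by auto
    then have "y \<in> (\<lambda>j. b (real j / real (2 * N))) ` {..l}"
      using that by (intro image_eqI[of _ _ "2 * j"]) auto
    then show "y \<le> Max ((\<lambda>j. b (real j / real (2 * N))) ` {..l})"
      by (intro Max_ge) auto
  qed auto
  have "2 * (\<Sum>k<N. ?w N k) = (\<Sum>k<N. ?w N k + ?w N k)"
    by (simp only: sum.distrib mult_2)
  also have "\<dots> \<le> (\<Sum>k<N. ?w (2 * N) (2 * k) + ?w (2 * N) (2 * k + 1))"
    by (intro sum_mono add_mono le) auto
  also have "\<dots> = (\<Sum>k<2 * N. ?w (2 * N) k)"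
    by (simp only: sum_lessThan_double)
  finally show ?thesis
    by (cases "N = 0") (simp_all add: grid_area_def walk_area_def divide_simps)
qed

lemma integral_grid_sum:
  fixes f :: "real \<Rightarrow> real"
  assumes "f integrable_on {0..1}" "N > 0"
  shows "integral {0..1} f = (\<Sum>k<N. integral {real k / real N..real (Suc k) / real N} f)"
proof -
  have "integral {0..real K / real N} f = (\<Sum>k<K. integral {real k / real N..real (Suc k) / real N} f)"
    if "K \<le> N" for K
    using that
  proof (induction K)
    case (Suc K)
    have "{0..real (Suc K) / real N} \<subseteq> {0..1}"
      using Suc.prems \<open>N > 0\<close> by (auto simp: divide_simps)
    then have "f integrable_on {0..real (Suc K) / real N}"
      using assms(1) integrable_on_subinterval by blast
    then have "integral {0..real K / real N} f + integral {real K / real N..real (Suc K) / real N} f =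
        integral {0..real (Suc K) / real N} f"
      by (intro Henstock_Kurzweil_Integration.integral_combine) (auto simp: divide_simps)
    with Suc show ?case by simp
  qed simp
  from this[of N] show ?thesis using \<open>N > 0\<close> by simp
qed

text \<open>By uniform continuity, on a fine grid the grid maximum at the left end of a cell is
  within e/2 of the running maximum throughout the cell.\<close>

lemma grid_area_tendsto:
  fixes b :: "real \<Rightarrow> real"
  assumes cont: "continuous_on {0..1} b" and b0: "b 0 = 0"
  shows "(\<lambda>N. grid_area N b) \<longlonglongrightarrow> integral {0..1} (\<lambda>t. Sup (b ` {0..t}))"
proof (rule LIMSEQ_I)
  define S where "S t = Sup (b ` {0..t})" for t
  have "bounded (b ` {0..1})"
    by (intro compact_imp_bounded compact_continuous_image cont) auto
  then have "bdd_above (b ` {0..1})"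
    by (rule bounded_imp_bdd_above)
  then have bdd: "bdd_above (b ` {0..t})" if "t \<le> 1" for t
    by (rule bdd_above_mono) (use that in auto)
  have "mono_on {0..1} S"
    unfolding S_def by (intro mono_onI cSup_subset_mono bdd image_mono) auto
  then have intS: "S integrable_on {0..1}"
    by (rule integrable_on_mono_on)
  fix e :: real assume "e > 0"
  then have e2: "e / 2 > 0" by simp
  have "uniformly_continuous_on {0..1} b"
    by (intro compact_uniformly_continuous cont) auto
  with e2 obtain d where d: "d > 0"
    "\<And>s t. s \<in> {0..1} \<Longrightarrow> t \<in> {0..1} \<Longrightarrow> dist s t < d \<Longrightarrow> dist (b s) (b t) < e / 2"
    unfolding uniformly_continuous_on_def by metis
  obtain N0 :: nat where N0: "N0 > 0" "1 / real N0 < d"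
    using d(1) by (metis nat_approx_posE zero_less_Suc)
  show "\<exists>N0. \<forall>N\<ge>N0. norm (grid_area N b - integral {0..1} S) < e"
  proof (intro exI allI impI)
    fix N assume "N \<ge> N0"
    then have N: "N > 0" "1 / real N < d"
      using N0 by (auto intro: le_less_trans[OF _ N0(2)] simp: frac_le)
    let ?w = "walk_max (path_incr N b)"
    have S: "?w k \<le> S t \<and> S t \<le> ?w k + e / 2"
      if k: "k < N" and t: "real k / real N \<le> t" "t \<le> real (Suc k) / real N" for k t
    proof
      have t1: "0 \<le> t" "t \<le> 1"
      proof -
        show "0 \<le> t" using t(1) by (rule order_trans[rotated]) simp
        have "real (Suc k) / real N \<le> 1" using k by simp
        then show "t \<le> 1" using t(2) by simp
      qed
      show "?w k \<le> S t"
        unfolding walk_max_path_incr[where b=b, OF b0]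
      proof (rule Max.boundedI)
        fix y assume "y \<in> (\<lambda>j. b (real j / real N)) ` {..k}"
        then obtain j where j: "j \<le> k" "y = b (real j / real N)" by auto
        have "real j / real N \<le> real k / real N"
          using j by (simp add: divide_right_mono)
        then show "y \<le> S t"
          unfolding S_def using j t t1 by (intro cSup_upper bdd) auto
      qed auto
      show "S t \<le> ?w k + e / 2"
        unfolding S_def
      proof (rule cSup_least)
        fix y assume "y \<in> b ` {0..t}"
        then obtain s where s: "0 \<le> s" "s \<le> t" "y = b s" by auto
        \<comment> \<open>The last grid point before s, capped at k: when s is the right end of the
          cell, the floor would be k + 1, which the maximum up to k does not cover.\<close>
        define j where "j = min k (nat \<lfloor>s * real N\<rfloor>)"
        have "s * real N \<le> real k + 1"
        proof -
          have "s \<le> real (Suc k) / real N" using s t by simp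
          then show ?thesis using N(1) by (simp add: field_simps)
        qed
        moreover have "0 \<le> s * real N" using s by simp
        ultimately have "real j \<le> s * real N" "s * real N \<le> real j + 1"
          unfolding j_def by (auto simp: min_def) linarith+
        then have jN: "real j / real N \<le> s" "s \<le> real j / real N + 1 / real N"
          using N(1) by (simp_all add: field_simps)
        have "dist s (real j / real N) < d"
          using jN N(2) by (simp add: dist_real_def)
        then have "dist (b s) (b (real j / real N)) < e / 2"
          using s t1 jN by (intro d) auto
        then have "b s \<le> b (real j / real N) + e / 2"
          unfolding dist_real_def by linarith
        moreover have "b (real j / real N) \<le> ?w k"
          unfolding walk_max_path_incr[where b=b, OF b0] by (intro Max_ge) (auto simp: j_def)
        ultimately show "y \<le> ?w k + e / 2" using s by simp
      qed (use t1 in auto)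
    qed
    have sub: "S integrable_on {real k / real N..real (Suc k) / real N}" if "k < N" for k
    proof -
      have "real (Suc k) / real N \<le> 1" using that by simp
      then have "{real k / real N..real (Suc k) / real N} \<subseteq> {0..1}" by auto
      then show ?thesis using intS integrable_on_subinterval by blast
    qed
    have const: "((\<lambda>_. c) has_integral c / real N) {real k / real N..real (Suc k) / real N}" for c :: real and k
    proof -
      have "real k / real N \<le> real (Suc k) / real N" by (simp add: divide_right_mono)
      moreover have "real (Suc k) / real N - real k / real N = 1 / real N"
        by (simp add: add_divide_distrib)
      ultimately show ?thesis
        using has_integral_const_real[of c "real k / real N" "real (Suc k) / real N"] by simp
    qed
    have "grid_area N b = (\<Sum>k<N. ?w k / real N)"
      by (simp add: grid_area_def walk_area_def sum_divide_distrib)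
    also have "\<dots> \<le> (\<Sum>k<N. integral {real k / real N..real (Suc k) / real N} S)"
      using S by (intro sum_mono has_integral_le[OF const integrable_integral[OF sub]]) auto
    finally have lower: "grid_area N b \<le> integral {0..1} S"
      by (simp only: integral_grid_sum[OF intS N(1)])
    have "integral {0..1} S \<le> (\<Sum>k<N. (?w k + e / 2) / real N)"
      unfolding integral_grid_sum[OF intS N(1)]
      using S by (intro sum_mono has_integral_le[OF integrable_integral[OF sub] const]) auto
    also have "\<dots> = grid_area N b + e / 2"
      using N(1) by (simp add: grid_area_def walk_area_def sum_divide_distrib[symmetric] sum.distrib add_divide_distrib)
    finally show "norm (grid_area N b - integral {0..1} S) < e"
      using lower \<open>e > 0\<close> by simp
  qed
qed

theorem theorem2:
  fixes M :: "'a measure" and B :: "real \<Rightarrow> 'a \<Rightarrow> real" and n :: nat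
  assumes "standard_brownian_motion M B"
  shows "integrable M (\<lambda>\<omega>. max_area B \<omega> ^ n) \<and>
         (\<integral>\<omega>. max_area B \<omega> ^ n \<partial>M) =
           fact n * Gamma (real n + 2/3) / (Gamma (2/3) * Gamma (3 * real n / 2 + 1))
             * (3 * sqrt 2 / 4) ^ n"
proof -
  have B [measurable]: "\<And>t. t \<ge> 0 \<Longrightarrow> B t \<in> borel_measurable M"
    and cont: "\<And>\<omega>. \<omega> \<in> space M \<Longrightarrow> continuous_on {0..} (\<lambda>t. B t \<omega>)"
    and B0: "\<And>\<omega>. \<omega> \<in> space M \<Longrightarrow> B 0 \<omega> = 0"
    using assms by (auto simp: standard_brownian_motion_def)
  define A where "A m \<omega> = grid_area (2 ^ m) (\<lambda>t. B t \<omega>)" for m \<omega>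
  have pow2: "filterlim (\<lambda>m. 2 ^ m :: nat) at_top sequentially"
    by (rule filterlim_subseq) (simp add: strict_mono_def)
  have A_lim: "(\<lambda>m. A m \<omega>) \<longlonglongrightarrow> max_area B \<omega>" if "\<omega> \<in> space M" for \<omega>
    unfolding A_def max_area_def running_max_def
    by (rule filterlim_compose[OF grid_area_tendsto pow2])
      (use that in \<open>auto intro: B0 continuous_on_subset[OF cont]\<close>)
  have A_meas [measurable]: "A m \<in> borel_measurable M" for m
  proof -
    have [measurable]: "(\<lambda>\<omega>. path_incr (2 ^ m) (\<lambda>t. B t \<omega>) i) \<in> borel_measurable M" for i
      unfolding path_incr_def by (intro borel_measurable_diff B) auto
    have "(\<lambda>\<omega>. path_incr (2 ^ m) (\<lambda>t. B t \<omega>)) \<in> M \<rightarrow>\<^sub>M gauss_seq"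
      by (rule measurable_PiM_single') (auto simp: measurable_cong_sets[OF refl sets_gauss])
    from measurable_compose[OF this measurable_walk_area] show ?thesis
      unfolding A_def[abs_def] grid_area_def by measurable
  qed
  have [measurable]: "(\<lambda>\<omega>. max_area B \<omega>) \<in> borel_measurable M"
    by (rule borel_measurable_LIMSEQ_real[OF A_lim A_meas])
  have A_incr: "A m \<omega> \<le> A (Suc m) \<omega>" if "\<omega> \<in> space M" for m \<omega>
    unfolding A_def power_Suc by (rule grid_area_double) (simp add: B0 that)
  have A_nonneg: "0 \<le> A m \<omega>" for m \<omega>
    by (simp add: A_def grid_area_nonneg)
  have nonneg: "0 \<le> max_area B \<omega>" if "\<omega> \<in> space M" for \<omega>
    by (rule LIMSEQ_le_const[OF A_lim[OF that]]) (simp add: A_nonneg)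
  \<comment> \<open>Paths are controlled only on \<open>space M\<close>; the indicator makes
    monotonicity and convergence hold at every point, as the convergence theorem demands.\<close>
  have "(\<lambda>m. \<integral>\<^sup>+\<omega>. ennreal (A m \<omega> ^ n) * indicator (space M) \<omega> \<partial>M) \<longlonglongrightarrow>
      (\<integral>\<^sup>+\<omega>. ennreal (max_area B \<omega> ^ n) * indicator (space M) \<omega> \<partial>M)"
  proof (rule nn_integral_LIMSEQ)
    show "incseq (\<lambda>m \<omega>. ennreal (A m \<omega> ^ n) * indicator (space M) \<omega>)"
      by (intro incseq_SucI le_funI)
        (auto simp: indicator_def intro!: ennreal_leI power_mono A_incr A_nonneg)
    show "(\<lambda>m. ennreal (A m \<omega> ^ n) * indicator (space M) \<omega>) \<longlonglongrightarrow>
        ennreal (max_area B \<omega> ^ n) * indicator (space M) \<omega>" for \<omega>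
      by (cases "\<omega> \<in> space M") (auto intro!: tendsto_ennrealI tendsto_power A_lim)
  qed measurable
  moreover have "(\<integral>\<^sup>+\<omega>. ennreal (f \<omega>) * indicator (space M) \<omega> \<partial>M) =
      (\<integral>\<^sup>+\<omega>. ennreal (f \<omega>) \<partial>M)" for f :: "'a \<Rightarrow> real"
    by (rule nn_integral_cong) simp
  moreover have "(\<integral>\<^sup>+\<omega>. ennreal (A m \<omega> ^ n) \<partial>M) =
      ennreal (area_moment n (2 ^ m) / real (2 ^ m) powr (3 * real n / 2))" for m
    unfolding A_def by (rule nn_integral_grid_area[OF assms]) simp
  ultimately have "(\<lambda>m. ennreal (area_moment n (2 ^ m) / real (2 ^ m) powr (3 * real n / 2)))
      \<longlonglongrightarrow> (\<integral>\<^sup>+\<omega>. ennreal (max_area B \<omega> ^ n) \<partial>M)"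
    by (simp only:)
  moreover have "(\<lambda>m. ennreal (area_moment n (2 ^ m) / real (2 ^ m) powr (3 * real n / 2)))
      \<longlonglongrightarrow> ennreal (area_const n)"
    by (rule tendsto_ennrealI[OF filterlim_compose[OF area_moment_limit pow2]])
  ultimately have "(\<integral>\<^sup>+\<omega>. ennreal (max_area B \<omega> ^ n) \<partial>M) = ennreal (area_const n)"
    by (rule LIMSEQ_unique)
  moreover have "0 \<le> area_const n"
    unfolding area_const_eq by (simp add: Gamma_real_nonneg)
  moreover have "AE \<omega> in M. 0 \<le> max_area B \<omega> ^ n"
    by (rule AE_I2) (simp add: nonneg)
  moreover have "(\<lambda>\<omega>. max_area B \<omega> ^ n) \<in> borel_measurable M"
    by measurable
  ultimately have "integrable M (\<lambda>\<omega>. max_area B \<omega> ^ n) \<and> (\<integral>\<omega>. max_area B \<omega> ^ n \<partial>M) = area_const n"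
    using nn_integral_eq_integrable by blast
  then show ?thesis by (simp only: area_const_eq)
qed

end
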